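(* Let $R$ be a finitely generated $\mathbb{Z}_{\geq 0}$-semiring and $\mathcal{L}$ a left cell in $R$ contained in an idempotent strongly regular two-sided cell. Then the cell $R$-semimodule $C_{\mathcal{L}}$ is minimal.
   Context: A semiring is a tuple $(R,+,\cdot,0,1)$ where $(R,+,0)$ is a commutative monoid, $(R,\cdot,1)$ is a monoid, multiplication distributes over addition on both sides, and $0a=a0=0$ for all $a\in R$. A (left) $R$-semimodule is a commutative monoid $(M,+,0_M)$ with a map $R\times M\to M$, $(r,m)\mapsto r(m)$, such that $r(m+n)=r(m)+r(n)$, $r(0_M)=0_M$, $(r+s)(m)=r(m)+s(m)$, $(rs)(m)=r(s(m))$, $0(m)=0_M$, $1(m)=m$. A subsemimodule is a submonoid closed under the action of $R$. A non-zero $R$-semimodule $M$ is called minimal if its only subsemimodules are $\{0_M\}$ and $M$. A finitely generated $\mathbb{Z}_{\geq 0}$-semiring is a semiring $R$ containing a finite $\mathbb{Z}_{\geq 0}$-basis $\mathbf{r}=\{r_1,\dots,r_k\}$, i.e. every element of $R$ can be written uniquely as a linear combination of elements of $\mathbf{r}$ with coefficients in $\mathbb{Z}_{\geq 0}$ (such a basis is unique). Cells. For $r_i,r_j\in\mathbf{r}$ write $r_i\leq_L r_j$ if there is $r\in R$ such that the coefficient of $r_j$ in $rr_i$ is non-zero; this is a pre-order, and its equivalence classes (on $\mathbf{r}$) are the left cells. The right pre-order $\leq_R$ and right cells are defined similarly using $r_ir$, and the two-sided pre-order $\leq_J$ and two-sided cells using $rr_ir'$ with $r,r'\in R$. A two-sided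 cell $\mathcal{J}$ is strongly regular if the intersection of any left cell and any right cell inside $\mathcal{J}$ is a singleton; it is idempotent if it contains (not necessarily distinct) elements $x,y,z$ such that $xy$ has a non-zero coefficient at $z$. Cell semimodules. Let $\rho$ be the congruence on $R$ under which $\sum_i a_ir_i$ and $\sum_i a_i'r_i$ are related iff, for all $i$, $a_i\neq 0\Leftrightarrow a_i'\neq 0$. The quotient $\tilde{R}=R/\rho$ is a semiring over the Boolean semiring $\mathbf{B}=\{0,1\}$ (with $1+1=1$) with basis the classes of the $r_i$, again denoted $r_i$. For a left cell $\mathcal{L}$, let $C_{\mathcal{L}}$ be the additive submonoid of $\tilde{R}$ generated by the $r_i\in\mathcal{L}$, and $\pi_{\mathcal{L}}:\tilde{R}\to C_{\mathcal{L}}$ the projection $\sum_i a_ir_i\mapsto\sum_{r_i\in\mathcal{L}}a_ir_i$. Then $r\cdot x:=\pi_{\mathcal{L}}(rx)$, $r\in\tilde{R}$, $x\in C_{\mathcal{L}}$, makes $C_{\mathcal{L}}$ an $\tilde{R}$-semimodule, and, via the projection $R\to\tilde{R}$, an $R$-semimodule, called the cell semimodule corresponding to $\mathcal{L}$. *)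

theory Defs
  imports Main
begin

text \<open>
  Semirings are types of sort \<open>{semiring_0, monoid_mult}\<close>. This is \<open>semiring_1\<close>
  without the axiom \<open>0 \<noteq> 1\<close>, so \<open>of_nat\<close> is not available and the multiple
  \<open>n b\<close> is written as the sum of \<open>n\<close> copies of \<open>b\<close>.
\<close>

section \<open>Semimodules\<close>

locale semimodule =
  fixes M :: "'m set"
    and add :: "'m \<Rightarrow> 'm \<Rightarrow> 'm"
    and zero :: "'m"
    and act :: "'r::{semiring_0, monoid_mult} \<Rightarrow> 'm \<Rightarrow> 'm"
  assumes zero_closed: "zero \<in> M"
    and add_closed: "\<lbrakk>m \<in> M; n \<in> M\<rbrakk> \<Longrightarrow> add m n \<in> M"
    and add_assoc: "\<lbrakk>m \<in> M; n \<in> M; p \<in> M\<rbrakk> \<Longrightarrow> add (add m n) p = add m (add n p)"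
    and add_commute: "\<lbrakk>m \<in> M; n \<in> M\<rbrakk> \<Longrightarrow> add m n = add n m"
    and add_zero: "m \<in> M \<Longrightarrow> add zero m = m"
    and act_closed: "m \<in> M \<Longrightarrow> act r m \<in> M"
    and act_add_right: "\<lbrakk>m \<in> M; n \<in> M\<rbrakk> \<Longrightarrow> act r (add m n) = add (act r m) (act r n)"
    and act_zero_right: "act r zero = zero"
    and act_add_left: "m \<in> M \<Longrightarrow> act (r + s) m = add (act r m) (act s m)"
    and act_mult: "m \<in> M \<Longrightarrow> act (r * s) m = act r (act s m)"
    and act_zero_left: "m \<in> M \<Longrightarrow> act 0 m = zero"
    and act_one: "m \<in> M \<Longrightarrow> act 1 m = m"
begin

definition subsemimodule :: "'m set \<Rightarrow> bool" where
  "subsemimodule N \<longleftrightarrow>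
     N \<subseteq> M \<and> zero \<in> N \<and> (\<forall>m\<in>N. \<forall>n\<in>N. add m n \<in> N) \<and> (\<forall>r. \<forall>m\<in>N. act r m \<in> N)"

end

locale minimal_semimodule = semimodule +
  assumes nonzero: "M \<noteq> {zero}"
    and minimal: "subsemimodule N \<Longrightarrow> N = {zero} \<or> N = M"


section \<open>Semirings with a finite basis over the non-negative integers\<close>

definition nat_lincomb :: "'a::comm_monoid_add set \<Rightarrow> ('a \<Rightarrow> nat) \<Rightarrow> 'a" where
  "nat_lincomb A c = (\<Sum>b\<in>A. \<Sum>i<c b. b)"

text \<open>Coefficient families are normalised to vanish outside the basis.\<close>

definition finite_nat_basis :: "'a::{semiring_0, monoid_mult} set \<Rightarrow> bool" where
  "finite_nat_basis B \<longleftrightarrow>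
     finite B \<and> (\<forall>x. \<exists>!c. (\<forall>b. b \<notin> B \<longrightarrow> c b = 0) \<and> x = nat_lincomb B c)"

definition basis_coeff :: "'a::{semiring_0, monoid_mult} set \<Rightarrow> 'a \<Rightarrow> 'a \<Rightarrow> nat" where
  "basis_coeff B x = (THE c. (\<forall>b. b \<notin> B \<longrightarrow> c b = 0) \<and> x = nat_lincomb B c)"


section \<open>Cells\<close>

definition le_L :: "'a::{semiring_0, monoid_mult} set \<Rightarrow> 'a \<Rightarrow> 'a \<Rightarrow> bool" where
  "le_L B x y \<longleftrightarrow> (\<exists>r. basis_coeff B (r * x) y \<noteq> 0)"

definition le_R :: "'a::{semiring_0, monoid_mult} set \<Rightarrow> 'a \<Rightarrow> 'a \<Rightarrow> bool" where
  "le_R B x y \<longleftrightarrow> (\<exists>r. basis_coeff B (x * r) y \<noteq> 0)"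

definition le_J :: "'a::{semiring_0, monoid_mult} set \<Rightarrow> 'a \<Rightarrow> 'a \<Rightarrow> bool" where
  "le_J B x y \<longleftrightarrow> (\<exists>r r'. basis_coeff B (r * x * r') y \<noteq> 0)"

definition left_cells :: "'a::{semiring_0, monoid_mult} set \<Rightarrow> 'a set set" where
  "left_cells B = B // {(x, y). x \<in> B \<and> y \<in> B \<and> le_L B x y \<and> le_L B y x}"

definition right_cells :: "'a::{semiring_0, monoid_mult} set \<Rightarrow> 'a set set" where
  "right_cells B = B // {(x, y). x \<in> B \<and> y \<in> B \<and> le_R B x y \<and> le_R B y x}"

definition two_sided_cells :: "'a::{semiring_0, monoid_mult} set \<Rightarrow> 'a set set" where
  "two_sided_cells B = B // {(x, y). x \<in> B \<and> y \<in> B \<and> le_J B x y \<and> le_J B y x}"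

definition strongly_regular_cell :: "'a::{semiring_0, monoid_mult} set \<Rightarrow> 'a set \<Rightarrow> bool" where
  "strongly_regular_cell B J \<longleftrightarrow>
     (\<forall>L\<in>left_cells B. \<forall>R\<in>right_cells B. L \<subseteq> J \<longrightarrow> R \<subseteq> J \<longrightarrow> is_singleton (L \<inter> R))"

definition idempotent_cell :: "'a::{semiring_0, monoid_mult} set \<Rightarrow> 'a set \<Rightarrow> bool" where
  "idempotent_cell B J \<longleftrightarrow> (\<exists>x\<in>J. \<exists>y\<in>J. \<exists>z\<in>J. basis_coeff B (x * y) z \<noteq> 0)"


section \<open>The Boolean quotient and cell semimodules\<close>

text \<open>
  Elements of the quotient semiring are the equivalence classes of \<open>supp_cong B\<close>.
  Its operations, and the projection onto the span of a cell, are given on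
  representatives; the unions are over families that are constant by congruence.
\<close>

definition supp_cong :: "'a::{semiring_0, monoid_mult} set \<Rightarrow> 'a rel" where
  "supp_cong B = {(x, y). \<forall>b\<in>B. basis_coeff B x b \<noteq> 0 \<longleftrightarrow> basis_coeff B y b \<noteq> 0}"

definition bool_class :: "'a::{semiring_0, monoid_mult} set \<Rightarrow> 'a \<Rightarrow> 'a set" where
  "bool_class B x = supp_cong B `` {x}"

definition bool_add :: "'a::{semiring_0, monoid_mult} set \<Rightarrow> 'a set \<Rightarrow> 'a set \<Rightarrow> 'a set" where
  "bool_add B X Y = (\<Union>x\<in>X. \<Union>y\<in>Y. bool_class B (x + y))"

definition bool_mult :: "'a::{semiring_0, monoid_mult} set \<Rightarrow> 'a set \<Rightarrow> 'a set \<Rightarrow> 'a set" where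
  "bool_mult B X Y = (\<Union>x\<in>X. \<Union>y\<in>Y. bool_class B (x * y))"

definition cell_proj :: "'a::{semiring_0, monoid_mult} set \<Rightarrow> 'a set \<Rightarrow> 'a set \<Rightarrow> 'a set" where
  "cell_proj B L X = (\<Union>x\<in>X. bool_class B (nat_lincomb L (basis_coeff B x)))"

inductive_set cell_carrier :: "'a::{semiring_0, monoid_mult} set \<Rightarrow> 'a set \<Rightarrow> 'a set set"
  for B L :: "'a set"
where
  zero: "bool_class B 0 \<in> cell_carrier B L"
| gen: "b \<in> L \<Longrightarrow> bool_class B b \<in> cell_carrier B L"
| add: "\<lbrakk>X \<in> cell_carrier B L; Y \<in> cell_carrier B L\<rbrakk> \<Longrightarrow> bool_add B X Y \<in> cell_carrier B L"

definition cell_act :: "'a::{semiring_0, monoid_mult} set \<Rightarrow> 'a set \<Rightarrow> 'a \<Rightarrow> 'a set \<Rightarrow> 'a set" where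
  "cell_act B L r X = cell_proj B L (bool_mult B (bool_class B r) X)"

end

theory Submission imports Defs begin

text \<open>
  Everything is governed by the support of an element, the set of basis elements that occur in
  it: coefficients are non-negative, so supports of sums and products are unions of
  supports (\<open>supp_additive_map\<close>). The cell semimodule of \<open>L\<close> becomes the set of subsets of
  \<open>L\<close> under union, where \<open>r\<close> sends the support of \<open>x\<close> to the part of the support of
  \<open>r * x\<close> that lies in \<open>L\<close>.

  Such a semimodule is minimal as soon as every non-empty \<open>X \<subseteq> L\<close> can be sent to every
  singleton \<open>{i}\<close> with \<open>i \<in> L\<close>, because the singletons generate it. Fix \<open>k \<in> X\<close>.
  Idempotency of \<open>J\<close> yields some \<open>b \<in> J\<close> that does not annihilate \<open>k\<close> in \<open>L\<close>
  (\<open>idempotent_cell_acts\<close>). Multiplying \<open>b\<close> from the left moves it within \<open>J\<close> until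
  \<open>i\<close> occurs in \<open>b * k\<close>. Now all elements of \<open>J\<close> that occur in a product \<open>b * x\<close> lie
  in the right cell of \<open>b\<close>, and by strong regularity this right cell meets \<open>L\<close> only in
  \<open>i\<close>. Hence \<open>b\<close> sends \<open>X\<close> to exactly \<open>{i}\<close> (\<open>exists_matrix_unit\<close>).

  This argument needs that two elements of the same two-sided cell which are comparable
  in a one-sided preorder are equivalent in it (\<open>le_L_sym_in_J\<close>, \<open>le_R_sym_in_J\<close>). For finite
  semigroups this stability follows by taking idempotent powers, which is of no help for products
  with several terms. Here it comes from a trace argument
  (\<open>commuting_maps_no_return\<close>): let \<open>a\<close> be the sum of the basis; the matrix of
  \<open>x \<mapsto> a * x\<close> commutes with the matrix of \<open>x \<mapsto> a * x * a\<close>, whose entries within a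
  two-sided cell are all positive, and a non-negative matrix commuting with a positive one cannot be
  block triangular without being block diagonal.
\<close>

section \<open>Coefficients and supports\<close>

definition additive_map :: "('a::comm_monoid_add \<Rightarrow> 'b::comm_monoid_add) \<Rightarrow> bool" where
  "additive_map f \<longleftrightarrow> f 0 = 0 \<and> (\<forall>x y. f (x + y) = f x + f y)"

lemma additive_map_sum:
  assumes "additive_map f"
  shows "f (\<Sum>i\<in>A. g i) = (\<Sum>i\<in>A. f (g i))"
proof (induction A rule: infinite_finite_induct)
qed (use assms in \<open>simp_all add: additive_map_def\<close>)

lemma additive_map_mult_left: "additive_map (\<lambda>x. r * x :: 'a::semiring_0)"
  by (simp add: additive_map_def distrib_left)

lemma additive_map_mult_right: "additive_map (\<lambda>x. x * r :: 'a::semiring_0)"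
  by (simp add: additive_map_def distrib_right)

lemma additive_map_mult_both: "additive_map (\<lambda>x. r * x * r' :: 'a::semiring_0)"
  by (simp add: additive_map_def distrib_left distrib_right)

lemma sum_const_add:
  fixes m n :: nat
  shows "(\<Sum>i<m + n. b) = (\<Sum>i<m. b) + (\<Sum>i<n. b :: 'a::comm_monoid_add)"
  by (induction n) (simp_all add: add.assoc)

lemma nat_lincomb_add:
  "nat_lincomb A (\<lambda>b. c b + d b) = nat_lincomb A c + nat_lincomb A d"
  by (simp add: nat_lincomb_def sum_const_add sum.distrib)

locale nat_based_semiring =
  fixes B :: "'a::{semiring_0, monoid_mult} set"
  assumes basis: "finite_nat_basis B"
begin

abbreviation coeff :: "'a \<Rightarrow> 'a \<Rightarrow> nat" where
  "coeff \<equiv> basis_coeff B"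

definition supp :: "'a \<Rightarrow> 'a set" where
  "supp x = {b. coeff x b \<noteq> 0}"

lemma finite_B [simp]: "finite B"
  using basis by (simp add: finite_nat_basis_def)

lemma coeff_characterization:
  "(\<forall>b. b \<notin> B \<longrightarrow> coeff x b = 0) \<and> x = nat_lincomb B (coeff x)"
proof -
  have "\<exists>!c. (\<forall>b. b \<notin> B \<longrightarrow> c b = 0) \<and> x = nat_lincomb B c"
    using basis by (simp add: finite_nat_basis_def)
  from theI'[OF this] show ?thesis
    unfolding basis_coeff_def .
qed

lemma coeff_outside: "b \<notin> B \<Longrightarrow> coeff x b = 0"
  using coeff_characterization by blast

lemma lincomb_coeff: "nat_lincomb B (coeff x) = x"
  using coeff_characterization by metis

lemma coeff_unique:
  assumes "\<And>b. b \<notin> B \<Longrightarrow> c b = 0" and "x = nat_lincomb B c"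
  shows "coeff x = c"
proof -
  have "\<exists>!c. (\<forall>b. b \<notin> B \<longrightarrow> c b = 0) \<and> x = nat_lincomb B c"
    using basis by (simp add: finite_nat_basis_def)
  then show ?thesis
    using assms coeff_characterization by blast
qed

lemma coeff_add: "coeff (x + y) b = coeff x b + coeff y b"
proof -
  have "coeff (x + y) = (\<lambda>b. coeff x b + coeff y b)"
    by (rule coeff_unique) (simp_all add: coeff_outside nat_lincomb_add lincomb_coeff)
  then show ?thesis by simp
qed

lemma coeff_zero: "coeff 0 b = 0"
proof -
  have "coeff 0 = (\<lambda>b. 0)"
    by (rule coeff_unique) (simp_all add: nat_lincomb_def)
  then show ?thesis by simp
qed

lemma coeff_lincomb:
  assumes "A \<subseteq> B"
  shows "coeff (nat_lincomb A c) b = (if b \<in> A then c b else 0)"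
proof -
  have "(\<Sum>b\<in>B. \<Sum>i<(if b \<in> A then c b else 0). b) = (\<Sum>b\<in>A. \<Sum>i<c b. b)"
    using assms by (intro sum.mono_neutral_cong_right) auto
  then have "coeff (nat_lincomb A c) = (\<lambda>b. if b \<in> A then c b else 0)"
    using assms by (intro coeff_unique) (auto simp: nat_lincomb_def)
  then show ?thesis by simp
qed

lemma coeff_basis:
  assumes "b \<in> B"
  shows "coeff b b' = (if b' = b then 1 else 0)"
  using coeff_lincomb[of "{b}" "\<lambda>_. 1" b'] assms by (simp add: nat_lincomb_def)

lemma additive_map_coeff: "additive_map (\<lambda>x. coeff x b)"
  by (simp add: additive_map_def coeff_zero coeff_add)

text \<open>
  Every operation used below (multiplication on one or on both sides) is additive, so its
  coefficients form a matrix of natural numbers and composition is matrix multiplication.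
\<close>

lemma coeff_additive_map:
  assumes "additive_map f"
  shows "coeff (f x) b = (\<Sum>z\<in>B. coeff x z * coeff (f z) b)"
proof -
  have "coeff (f x) b = coeff (f (nat_lincomb B (coeff x))) b"
    by (simp add: lincomb_coeff)
  also have "\<dots> = (\<Sum>z\<in>B. \<Sum>i<coeff x z. coeff (f z) b)"
    by (simp add: nat_lincomb_def additive_map_sum[OF assms]
        additive_map_sum[OF additive_map_coeff])
  finally show ?thesis by simp
qed

lemma supp_subset: "supp x \<subseteq> B"
proof
  show "b \<in> B" if "b \<in> supp x" for b
    using that coeff_outside[of b x] by (auto simp: supp_def)
qed

lemma supp_zero [simp]: "supp 0 = {}"
  by (simp add: supp_def coeff_zero)

lemma supp_add [simp]: "supp (x + y) = supp x \<union> supp y"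
  by (auto simp: supp_def coeff_add)

lemma supp_basis: "b \<in> B \<Longrightarrow> supp b = {b}"
  by (auto simp: supp_def coeff_basis)

lemma supp_lincomb: "A \<subseteq> B \<Longrightarrow> supp (nat_lincomb A (coeff x)) = supp x \<inter> A"
  by (auto simp: supp_def coeff_lincomb)

text \<open>No cancellation can occur between non-negative coefficients.\<close>

lemma supp_additive_map:
  assumes "additive_map f"
  shows "supp (f x) = (\<Union>z\<in>supp x. supp (f z))"
proof -
  have "b \<in> supp (f x) \<longleftrightarrow> (\<exists>z\<in>B. coeff x z \<noteq> 0 \<and> coeff (f z) b \<noteq> 0)" for b
    by (auto simp: supp_def coeff_additive_map[OF assms, of x])
  then show ?thesis
    using supp_subset[of x] by (auto simp: supp_def)
qed

lemma supp_mult_left: "supp (r * x) = (\<Union>z\<in>supp x. supp (r * z))"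
  by (rule supp_additive_map[OF additive_map_mult_left])

lemma supp_mult_right: "supp (x * r) = (\<Union>z\<in>supp x. supp (z * r))"
  by (rule supp_additive_map[OF additive_map_mult_right])

lemma supp_mult_both: "supp (r * x * r') = (\<Union>z\<in>supp x. supp (r * z * r'))"
  by (rule supp_additive_map[OF additive_map_mult_both])


section \<open>The cell preorders\<close>

lemma le_L_iff: "le_L B x y \<longleftrightarrow> (\<exists>r. y \<in> supp (r * x))"
  by (simp add: le_L_def supp_def)

lemma le_R_iff: "le_R B x y \<longleftrightarrow> (\<exists>r. y \<in> supp (x * r))"
  by (simp add: le_R_def supp_def)

lemma le_J_iff: "le_J B x y \<longleftrightarrow> (\<exists>r r'. y \<in> supp (r * x * r'))"
  by (simp add: le_J_def supp_def)

lemma le_L_trans: "le_L B x y \<Longrightarrow> le_L B y z \<Longrightarrow> le_L B x z"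
  unfolding le_L_iff
proof (elim exE)
  fix r r'
  assume "y \<in> supp (r * x)" "z \<in> supp (r' * y)"
  then have "z \<in> supp (r' * (r * x))" by (subst supp_mult_left) blast
  then show "\<exists>r. z \<in> supp (r * x)" by (metis mult.assoc)
qed

lemma le_R_trans: "le_R B x y \<Longrightarrow> le_R B y z \<Longrightarrow> le_R B x z"
  unfolding le_R_iff
proof (elim exE)
  fix r r'
  assume "y \<in> supp (x * r)" "z \<in> supp (y * r')"
  then have "z \<in> supp (x * r * r')" by (subst supp_mult_right) blast
  then show "\<exists>r. z \<in> supp (x * r)" by (metis mult.assoc)
qed

lemma le_J_trans: "le_J B x y \<Longrightarrow> le_J B y z \<Longrightarrow> le_J B x z"
  unfolding le_J_iff
proof (elim exE)
  fix r r' s s'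
  assume "y \<in> supp (r * x * r')" "z \<in> supp (s * y * s')"
  then have "z \<in> supp (s * (r * x * r') * s')" by (subst supp_mult_both) blast
  then have "z \<in> supp ((s * r) * x * (r' * s'))" by (simp add: mult.assoc)
  then show "\<exists>r r'. z \<in> supp (r * x * r')" by blast
qed

lemma le_L_refl: "x \<in> B \<Longrightarrow> le_L B x x"
  unfolding le_L_iff by (metis mult_1_left supp_basis singletonI)

lemma le_R_refl: "x \<in> B \<Longrightarrow> le_R B x x"
  unfolding le_R_iff by (metis mult_1_right supp_basis singletonI)

lemma le_L_imp_le_J: "le_L B x y \<Longrightarrow> le_J B x y"
  unfolding le_L_iff le_J_iff by (metis mult_1_right)

lemma le_R_imp_le_J: "le_R B x y \<Longrightarrow> le_J B x y"
  unfolding le_R_iff le_J_iff by (metis mult_1_left)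

lemma supp_mult_le_L: "y \<in> supp (r * x) \<Longrightarrow> le_L B x y"
  by (auto simp: le_L_iff)

lemma supp_mult_le_R: "y \<in> supp (x * r) \<Longrightarrow> le_R B x y"
  by (auto simp: le_R_iff)

lemmas supp_mult_le_J = le_L_imp_le_J[OF supp_mult_le_L] le_R_imp_le_J[OF supp_mult_le_R]

text \<open>
  Multiplication by the sum of the basis detects the preorders all at once, because every
  basis element occurs in that sum.
\<close>

lemma supp_sum_basis: "supp (\<Sum>B) = B"
proof -
  have "\<Sum>B = nat_lincomb B (\<lambda>_. 1)" by (simp add: nat_lincomb_def)
  then show ?thesis by (auto simp: supp_def coeff_lincomb)
qed

lemma supp_mult_le_sum_left: "supp (r * x) \<subseteq> supp (\<Sum>B * x)"
  using supp_mult_right[where r = x] supp_subset[of r] supp_sum_basis by blast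

lemma supp_mult_le_sum_right: "supp (x * r) \<subseteq> supp (x * \<Sum>B)"
  using supp_mult_left[where r = x] supp_subset[of r] supp_sum_basis by blast

lemma le_L_iff_sum: "le_L B x y \<longleftrightarrow> y \<in> supp (\<Sum>B * x)"
  using supp_mult_le_sum_left by (auto simp: le_L_iff)

lemma le_R_iff_sum: "le_R B x y \<longleftrightarrow> y \<in> supp (x * \<Sum>B)"
  using supp_mult_le_sum_right by (auto simp: le_R_iff)

lemma le_J_iff_sum: "le_J B x y \<longleftrightarrow> y \<in> supp (\<Sum>B * x * \<Sum>B)"
proof -
  have "supp (r * x * r') \<subseteq> supp (\<Sum>B * x * \<Sum>B)" for r r'
    using supp_mult_le_sum_left[of r "x * r'"] supp_mult_le_sum_right[of "\<Sum>B * x" r']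
    by (simp add: mult.assoc)
  then show ?thesis by (auto simp: le_J_iff)
qed


section \<open>Incomparability of one-sided cells inside a two-sided cell\<close>

text \<open>
  Let \<open>F\<close> and \<open>G\<close> be the matrices of \<open>f\<close> and \<open>g\<close>. Compare the sums of the diagonal entries
  indexed by \<open>S\<close> of \<open>F G\<close> and of \<open>G F\<close>. The contributions that stay inside \<open>S\<close>
  agree, as in the proof that a trace is cyclic; those of \<open>G F\<close> that go from \<open>S\<close>
  out of \<open>S\<close> by \<open>F\<close> and back by \<open>G\<close> vanish by hypothesis. Since the entries are
  non-negative and \<open>F G = G F\<close>, each contribution to \<open>F G\<close> that leaves \<open>S\<close> by \<open>G\<close> and
  comes back by \<open>F\<close> vanishes too.
\<close>

lemma commuting_maps_no_return:
  assumes f: "additive_map f" and g: "additive_map g"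
    and comm: "\<And>x. f (g x) = g (f x)"
    and S: "S \<subseteq> B"
    and no_return: "\<And>s z. \<lbrakk>s \<in> S; z \<in> B - S; z \<in> supp (f s)\<rbrakk> \<Longrightarrow> s \<notin> supp (g z)"
    and s: "s \<in> S" and z: "z \<in> B - S" and "z \<in> supp (g s)"
  shows "s \<notin> supp (f z)"
proof -
  define F where "F y x = coeff (f x) y" for x y
  define G where "G y x = coeff (g x) y" for x y
  have [simp]: "finite S" using S finite_B by (rule finite_subset)
  have split: "(\<Sum>z\<in>B. h z) = (\<Sum>z\<in>S. h z) + (\<Sum>z\<in>B - S. h z)" for h :: "'a \<Rightarrow> nat"
    using S by (simp add: sum.subset_diff)
  have inside: "(\<Sum>s\<in>S. \<Sum>z\<in>S. G z s * F s z) = (\<Sum>s\<in>S. \<Sum>z\<in>S. F z s * G s z)"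
    by (subst sum.swap) (simp add: mult.commute)
  have leave: "(\<Sum>s\<in>S. \<Sum>z\<in>B - S. F z s * G s z) = 0"
  proof (intro sum.neutral ballI)
    show "F z s * G s z = 0" if "s \<in> S" "z \<in> B - S" for s z
      using no_return[OF that] by (cases "F z s = 0") (auto simp: F_def G_def supp_def)
  qed
  have "(\<Sum>s\<in>S. \<Sum>z\<in>B. G z s * F s z) = (\<Sum>s\<in>S. coeff (f (g s)) s)"
    by (simp add: coeff_additive_map[OF f, of "g _"] F_def G_def)
  also have "\<dots> = (\<Sum>s\<in>S. \<Sum>z\<in>B. F z s * G s z)"
    by (simp add: comm coeff_additive_map[OF g, of "f _"] F_def G_def)
  finally have "(\<Sum>s\<in>S. \<Sum>z\<in>B - S. G z s * F s z) = 0"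
    using inside leave by (simp add: split sum.distrib)
  then have "G z s * F s z = 0"
    using s z by simp
  then show ?thesis
    using \<open>z \<in> supp (g s)\<close> by (simp add: F_def G_def supp_def)
qed

text \<open>
  The previous lemma is applied to the set \<open>S\<close> of those elements of the two-sided cell of
  \<open>y\<close> that are above \<open>y\<close> in the left preorder. Left multiplication leaves \<open>S\<close> only
  by leaving the two-sided cell upwards, from where two-sided multiplication cannot return. If
  \<open>x\<close> were outside \<open>S\<close>, it would still occur in \<open>\<Sum>B * y * \<Sum>B\<close>, so \<open>y\<close> could not
  occur in \<open>\<Sum>B * x\<close>.
\<close>

lemma le_L_sym_in_J:
  assumes "x \<in> B" "y \<in> B" and xy: "le_L B x y" and yx: "le_J B y x"
  shows "le_L B y x"
proof (rule ccontr)
  assume neg: "\<not> le_L B y x"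
  define S where "S = {s. le_L B y s \<and> le_J B s y}"
  have S: "S \<subseteq> B" using supp_subset by (auto simp: S_def le_L_iff_sum)
  have "y \<notin> supp (\<Sum>B * x)"
  proof (rule commuting_maps_no_return[OF additive_map_mult_left additive_map_mult_both _ S])
    show "\<Sum>B * (\<Sum>B * z * \<Sum>B) = \<Sum>B * (\<Sum>B * z) * \<Sum>B" for z by (simp add: mult.assoc)
    show "y \<in> S" using \<open>y \<in> B\<close> by (simp add: S_def le_L_refl le_L_imp_le_J)
    show "x \<in> B - S" using \<open>x \<in> B\<close> neg by (simp add: S_def)
    show "x \<in> supp (\<Sum>B * y * \<Sum>B)" using yx by (simp add: le_J_iff_sum)
    show "s \<notin> supp (\<Sum>B * z * \<Sum>B)" if "s \<in> S" "z \<in> B - S" "z \<in> supp (\<Sum>B * s)" for s z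
    proof
      assume "s \<in> supp (\<Sum>B * z * \<Sum>B)"
      then have "le_J B z s" by (simp add: le_J_iff_sum)
      moreover have "le_L B s z" using that by (simp add: le_L_iff_sum)
      ultimately have "z \<in> S"
        using that(1) le_L_trans le_J_trans unfolding S_def by blast
      then show False using that(2) by blast
    qed
  qed
  then show False using xy by (simp add: le_L_iff_sum)
qed

lemma le_R_sym_in_J:
  assumes "x \<in> B" "y \<in> B" and xy: "le_R B x y" and yx: "le_J B y x"
  shows "le_R B y x"
proof (rule ccontr)
  assume neg: "\<not> le_R B y x"
  define S where "S = {s. le_R B y s \<and> le_J B s y}"
  have S: "S \<subseteq> B" using supp_subset by (auto simp: S_def le_R_iff_sum)
  have "y \<notin> supp (x * \<Sum>B)"
  proof (rule commuting_maps_no_return[OF additive_map_mult_right additive_map_mult_both _ S])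
    show "\<Sum>B * z * \<Sum>B * \<Sum>B = \<Sum>B * (z * \<Sum>B) * \<Sum>B" for z by (simp add: mult.assoc)
    show "y \<in> S" using \<open>y \<in> B\<close> by (simp add: S_def le_R_refl le_R_imp_le_J)
    show "x \<in> B - S" using \<open>x \<in> B\<close> neg by (simp add: S_def)
    show "x \<in> supp (\<Sum>B * y * \<Sum>B)" using yx by (simp add: le_J_iff_sum)
    show "s \<notin> supp (\<Sum>B * z * \<Sum>B)" if "s \<in> S" "z \<in> B - S" "z \<in> supp (s * \<Sum>B)" for s z
    proof
      assume "s \<in> supp (\<Sum>B * z * \<Sum>B)"
      then have "le_J B z s" by (simp add: le_J_iff_sum)
      moreover have "le_R B s z" using that by (simp add: le_R_iff_sum)
      ultimately have "z \<in> S"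
        using that(1) le_R_trans le_J_trans unfolding S_def by blast
      then show False using that(2) by blast
    qed
  qed
  then show False using xy by (simp add: le_R_iff_sum)
qed


section \<open>Cells\<close>

lemma left_cell_iff:
  assumes "L \<in> left_cells B" and "k \<in> L"
  shows "y \<in> L \<longleftrightarrow> y \<in> B \<and> le_L B k y \<and> le_L B y k"
proof -
  obtain x where "L = {y \<in> B. le_L B x y \<and> le_L B y x}"
    using assms(1) by (auto simp: left_cells_def quotient_def)
  then show ?thesis
    using assms(2) le_L_trans by blast
qed

lemma left_cell_nonempty: "L \<in> left_cells B \<Longrightarrow> L \<noteq> {}"
  using le_L_refl by (auto simp: left_cells_def quotient_def)

lemma two_sided_cell_iff:
  assumes "J \<in> two_sided_cells B" and "k \<in> J"
  shows "y \<in> J \<longleftrightarrow> y \<in> B \<and> le_J B k y \<and> le_J B y k"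
proof -
  obtain x where "J = {y \<in> B. le_J B x y \<and> le_J B y x}"
    using assms(1) by (auto simp: two_sided_cells_def quotient_def)
  then show ?thesis
    using assms(2) le_J_trans by blast
qed

lemma two_sided_cell_convex:
  assumes "J \<in> two_sided_cells B" "x \<in> J" "z \<in> J" "y \<in> B" "le_J B x y" "le_J B y z"
  shows "y \<in> J"
  using assms two_sided_cell_iff[of J x] le_J_trans by blast

text \<open>The right cell through an element of \<open>J\<close> stays inside \<open>J\<close>, so strong regularity applies.\<close>

lemma strongly_regular_cell_unique:
  assumes J: "J \<in> two_sided_cells B" and "strongly_regular_cell B J"
    and L: "L \<in> left_cells B" "L \<subseteq> J"
    and i: "i \<in> L" and j: "j \<in> L" and ij: "le_R B i j" "le_R B j i"
  shows "i = j"
proof -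
  define C where "C = {y \<in> B. le_R B i y \<and> le_R B y i}"
  have iB: "i \<in> B" and jB: "j \<in> B" using left_cell_iff[OF L(1) i] i j by auto
  have "C \<in> right_cells B"
    unfolding right_cells_def C_def using iB by (auto simp: quotient_def)
  moreover have "C \<subseteq> J"
    using two_sided_cell_iff[OF J subsetD[OF L(2) i]] le_R_imp_le_J by (auto simp: C_def)
  ultimately have "is_singleton (L \<inter> C)"
    using assms by (auto simp: strongly_regular_cell_def)
  moreover have "i \<in> L \<inter> C" "j \<in> L \<inter> C"
    using i j ij iB jB le_R_refl by (auto simp: C_def)
  ultimately show ?thesis by (metis is_singleton_def singletonD)
qed

text \<open>
  If \<open>z\<close> occurs in \<open>x * y\<close> with all three in \<open>J\<close>, and \<open>y\<close> occurs in \<open>p * k * q\<close>, then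
  \<open>z\<close> occurs in \<open>(x * p) * k * q\<close>. The basis elements \<open>b\<close> of \<open>x * p\<close> and \<open>t\<close> of
  \<open>b * k\<close> responsible for \<open>z\<close> lie between elements of \<open>J\<close>, hence in \<open>J\<close>;
  moreover \<open>t\<close> is above \<open>k\<close> in the left preorder, hence in the same left cell.
\<close>

lemma idempotent_cell_acts:
  assumes J: "J \<in> two_sided_cells B" and "idempotent_cell B J"
    and L: "L \<in> left_cells B" "L \<subseteq> J" and k: "k \<in> L"
  obtains b t where "b \<in> J" "t \<in> L" "t \<in> supp (b * k)"
proof -
  obtain x y z where xyz: "x \<in> J" "y \<in> J" "z \<in> J" "z \<in> supp (x * y)"
    using assms(2) by (auto simp: idempotent_cell_def supp_def)
  have kJ: "k \<in> J" using L k by auto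
  have "le_J B k y" using two_sided_cell_iff[OF J kJ] xyz(2) by blast
  then obtain p q where "y \<in> supp (p * k * q)" by (auto simp: le_J_iff)
  then have "z \<in> supp (x * (p * k * q))"
    using xyz(4) by (subst supp_mult_left) blast
  then have "z \<in> supp ((x * p * k) * q)" by (simp add: mult.assoc)
  then obtain t where t: "t \<in> supp (x * p * k)" "z \<in> supp (t * q)"
    unfolding supp_mult_right[of "x * p * k" q] by blast
  from t(1) obtain b where b: "b \<in> supp (x * p)" "t \<in> supp (b * k)"
    unfolding supp_mult_right[of "x * p" k] by blast
  have tB: "t \<in> B" "b \<in> B" using t b supp_subset by auto
  have kt: "le_L B k t" using b(2) by (rule supp_mult_le_L)
  have tJ: "t \<in> J"
    using two_sided_cell_convex[OF J kJ xyz(3) tB(1)] le_L_imp_le_J[OF kt] supp_mult_le_J(2)[OF t(2)]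
    by blast
  have "b \<in> J"
    using two_sided_cell_convex[OF J xyz(1) tJ tB(2)] b supp_mult_le_J(2) by blast
  moreover have "t \<in> L"
  proof -
    have "k \<in> B" "le_J B t k" using two_sided_cell_iff[OF J tJ] kJ by auto
    then have "le_L B t k" using le_L_sym_in_J[OF _ tB(1) kt] by blast
    then show ?thesis using left_cell_iff[OF L(1) k] kt tB by blast
  qed
  ultimately show thesis using b(2) that by blast
qed

text \<open>
  Within \<open>J\<close>, an element \<open>b\<close> of the right cell of \<open>i\<close> can only produce elements of that
  right cell, and \<open>i\<close> is the only one of them in \<open>L\<close>. So it suffices to find \<open>b \<in> J\<close>
  such that \<open>i\<close> occurs in \<open>b * k\<close>; then \<open>b\<close> acts on the span of \<open>L\<close> like a sum of
  matrix units with row \<open>i\<close>, one of which has column \<open>k\<close>.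
\<close>

lemma exists_matrix_unit:
  assumes J: "J \<in> two_sided_cells B" and idem: "idempotent_cell B J"
    and sr: "strongly_regular_cell B J"
    and L: "L \<in> left_cells B" "L \<subseteq> J" and k: "k \<in> L" and i: "i \<in> L"
  obtains b where "\<And>x. k \<in> supp x \<Longrightarrow> supp (b * x) \<inter> L = {i}"
proof -
  obtain b0 t where b0: "b0 \<in> J" "t \<in> L" "t \<in> supp (b0 * k)"
    by (rule idempotent_cell_acts[OF J idem L k])
  have "le_L B t i" using left_cell_iff[OF L(1) b0(2)] i by blast
  then obtain r where "i \<in> supp (r * t)" by (auto simp: le_L_iff)
  then have "i \<in> supp (r * (b0 * k))"
    using b0(3) by (subst supp_mult_left) blast
  then have "i \<in> supp ((r * b0) * k)" by (simp add: mult.assoc)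
  then obtain b where b: "b \<in> supp (r * b0)" "i \<in> supp (b * k)"
    unfolding supp_mult_right[of "r * b0" k] by blast
  have bB: "b \<in> B" using b supp_subset by auto
  have iJ: "i \<in> J" using i L by auto
  have bJ: "b \<in> J"
    using two_sided_cell_convex[OF J b0(1) iJ bB] supp_mult_le_J(1)[OF b(1)]
      supp_mult_le_J(2)[OF b(2)] by blast
  have right_cell: "le_R B b j \<and> le_R B j b" if "j \<in> L" "j \<in> supp (b * x)" for j x
  proof -
    have "j \<in> J" using that L by auto
    then have "j \<in> B" "le_J B j b" using two_sided_cell_iff[OF J bJ] by auto
    moreover have "le_R B b j" using that(2) by (rule supp_mult_le_R)
    ultimately show ?thesis using le_R_sym_in_J[OF bB] by blast
  qed
  have "supp (b * x) \<inter> L = {i}" if kx: "k \<in> supp x" for x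
  proof -
    have "i \<in> supp (b * x)"
      unfolding supp_mult_left[of b x] using kx b(2) by (rule UN_I)
    moreover have "j = i" if "j \<in> L" "j \<in> supp (b * x)" for j
    proof (rule strongly_regular_cell_unique[OF J sr L that(1) i])
      show "le_R B j i" "le_R B i j"
        using right_cell[OF that] right_cell[OF i b(2)] le_R_trans[of j b i] le_R_trans[of i b j]
        by simp_all
    qed
    ultimately show ?thesis using i by blast
  qed
  then show thesis by (rule that)
qed


section \<open>The cell semimodule in terms of supports\<close>

lemma bool_class_eq: "bool_class B x = {y. supp y = supp x}"
  using coeff_outside by (fastforce simp: bool_class_def supp_cong_def supp_def)

lemma bool_class_eq_iff: "bool_class B x = bool_class B y \<longleftrightarrow> supp x = supp y"
  by (auto simp: bool_class_eq)

lemma bool_class_refl: "x \<in> bool_class B x"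
  by (simp add: bool_class_eq)

lemma bool_add_class: "bool_add B (bool_class B x) (bool_class B y) = bool_class B (x + y)"
  by (auto simp: bool_add_def bool_class_eq)

lemma supp_mult_cong:
  assumes "supp x = supp x'" "supp y = supp y'"
  shows "supp (x * y) = supp (x' * y')"
  using supp_mult_left[of x y] supp_mult_left[of x y'] supp_mult_right[of x y']
    supp_mult_right[of x' y'] assms by simp

lemma bool_mult_class: "bool_mult B (bool_class B x) (bool_class B y) = bool_class B (x * y)"
proof -
  have "bool_class B (x' * y') = bool_class B (x * y)"
    if "x' \<in> bool_class B x" "y' \<in> bool_class B y" for x' y'
    using that supp_mult_cong[of x' x y' y] by (simp add: bool_class_eq)
  then show ?thesis
    unfolding bool_mult_def using bool_class_refl by blast
qed

lemma cell_proj_class: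
  assumes "L \<subseteq> B"
  shows "cell_proj B L (bool_class B x) = bool_class B (nat_lincomb L (coeff x))"
proof -
  have "bool_class B (nat_lincomb L (coeff x')) = bool_class B (nat_lincomb L (coeff x))"
    if "x' \<in> bool_class B x" for x'
    using that assms by (simp add: bool_class_eq supp_lincomb)
  then show ?thesis
    unfolding cell_proj_def using bool_class_refl by blast
qed

lemma cell_act_class:
  assumes "L \<subseteq> B"
  shows "cell_act B L r (bool_class B x) = bool_class B (nat_lincomb L (coeff (r * x)))"
  by (simp add: cell_act_def bool_mult_class cell_proj_class assms)

text \<open>
  A class is the sum of the classes of the basis elements in its support, each taken once, since
  addition of classes is idempotent. This serves both to describe the cell semimodule and
  to recognise a subsemimodule that is the whole of it.
\<close>

lemma bool_class_in_closed_family: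
  assumes zero: "bool_class B 0 \<in> N"
    and add: "\<And>X Y. X \<in> N \<Longrightarrow> Y \<in> N \<Longrightarrow> bool_add B X Y \<in> N"
    and gen: "\<And>b. b \<in> supp x \<Longrightarrow> bool_class B b \<in> N"
  shows "bool_class B x \<in> N"
proof -
  have "finite (supp x)" using supp_subset finite_B by (rule finite_subset)
  have "finite A \<Longrightarrow> A \<subseteq> supp x \<Longrightarrow> \<exists>y. supp y = A \<and> bool_class B y \<in> N" for A
  proof (induction A rule: finite_induct)
    case empty
    show ?case using zero supp_zero by blast
  next
    case (insert b A)
    then obtain y where y: "supp y = A" "bool_class B y \<in> N" by auto
    have "b \<in> B" using insert.prems supp_subset by auto
    then have "supp (b + y) = insert b A" using y by (simp add: supp_basis)
    moreover have "bool_class B (b + y) \<in> N"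
      using add[OF gen[of b] y(2)] insert.prems by (simp add: bool_add_class)
    ultimately show ?case by blast
  qed
  with \<open>finite (supp x)\<close> show ?thesis using bool_class_eq_iff by (metis order_refl)
qed

lemma cell_carrier_eq:
  assumes "L \<subseteq> B"
  shows "cell_carrier B L = bool_class B ` {x. supp x \<subseteq> L}"
proof (intro equalityI subsetI)
  fix X assume "X \<in> cell_carrier B L"
  then show "X \<in> bool_class B ` {x. supp x \<subseteq> L}"
  proof induction
    case zero
    show ?case by (rule imageI) simp
  next
    case (gen b)
    then have "supp b \<subseteq> L" using assms by (auto simp: supp_basis)
    then show ?case by simp
  next
    case (add X Y)
    then obtain x y where "X = bool_class B x" "Y = bool_class B y" "supp x \<subseteq> L" "supp y \<subseteq> L"
      by auto
    then show ?case by (auto simp: bool_add_class)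
  qed
next
  fix X assume "X \<in> bool_class B ` {x. supp x \<subseteq> L}"
  then obtain x where "X = bool_class B x" "supp x \<subseteq> L" by auto
  then show "X \<in> cell_carrier B L"
    using bool_class_in_closed_family[OF cell_carrier.zero cell_carrier.add cell_carrier.gen]
    by blast
qed

text \<open>
  Truncating after the first of two multiplications changes nothing in \<open>L\<close>: what leaves
  \<open>L\<close> upwards in the left preorder does not come back.
\<close>

lemma supp_mult_truncate:
  assumes L: "L \<in> left_cells B" "L \<subseteq> B" and x: "supp x \<subseteq> L"
  shows "supp (r * nat_lincomb L (coeff (s * x))) \<inter> L = supp (r * (s * x)) \<inter> L"
proof -
  have "t \<in> L" if t: "t \<in> supp (s * x)" and j: "j \<in> supp (r * t)" "j \<in> L" for t j
  proof -
    from t obtain k where k: "k \<in> supp x" "t \<in> supp (s * k)"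
      unfolding supp_mult_left[of s x] by blast
    have "le_L B k t" "le_L B t j" using k j supp_mult_le_L by blast+
    moreover have "k \<in> L" using k x by auto
    moreover have "t \<in> B" using t supp_subset by auto
    ultimately show ?thesis
      using left_cell_iff[OF L(1), of k] j le_L_trans by blast
  qed
  then show ?thesis
    using supp_mult_left[of r "nat_lincomb L (coeff (s * x))"] supp_mult_left[of r "s * x"]
    by (auto simp: supp_lincomb[OF L(2)])
qed

lemma semimodule_cell:
  assumes L: "L \<in> left_cells B" "L \<subseteq> B"
  shows "semimodule (cell_carrier B L) (bool_add B) (bool_class B 0) (cell_act B L)"
proof
  note simps = cell_carrier_eq[OF L(2)] bool_add_class cell_act_class[OF L(2)]
    bool_class_eq_iff supp_lincomb[OF L(2)]
  fix m n p r s
  show "bool_class B 0 \<in> cell_carrier B L" by (rule cell_carrier.zero)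
  show "cell_act B L r (bool_class B 0) = bool_class B 0" by (simp add: simps)
  assume "m \<in> cell_carrier B L"
  then obtain x where m: "m = bool_class B x" and x: "supp x \<subseteq> L" by (auto simp: simps)
  show "bool_add B (bool_class B 0) m = m"
    by (simp add: m simps)
  show "cell_act B L r m \<in> cell_carrier B L"
    unfolding m simps by (intro imageI) (simp add: simps)
  show "cell_act B L (r + s) m = bool_add B (cell_act B L r m) (cell_act B L s m)"
    by (auto simp: m simps distrib_right)
  show "cell_act B L (r * s) m = cell_act B L r (cell_act B L s m)"
    using supp_mult_truncate[OF L x] by (simp add: m simps mult.assoc)
  show "cell_act B L 0 m = bool_class B 0"
    by (simp add: m simps)
  show "cell_act B L 1 m = m"
    using x by (auto simp: m simps)
  assume "n \<in> cell_carrier B L"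
  then obtain y where n: "n = bool_class B y" and y: "supp y \<subseteq> L" by (auto simp: simps)
  show "bool_add B m n \<in> cell_carrier B L"
    unfolding m n simps by (intro imageI) (use x y in simp)
  show "bool_add B m n = bool_add B n m"
    by (simp add: m n simps add.commute)
  show "cell_act B L r (bool_add B m n) = bool_add B (cell_act B L r m) (cell_act B L r n)"
    by (auto simp: m n simps distrib_left)
  assume "p \<in> cell_carrier B L"
  then obtain z where p: "p = bool_class B z" by (auto simp: simps)
  show "bool_add B (bool_add B m n) p = bool_add B m (bool_add B n p)"
    by (simp add: m n p simps add.assoc)
qed

lemma minimal_semimodule_cell:
  assumes L: "L \<in> left_cells B" "L \<subseteq> J" and J: "J \<in> two_sided_cells B"
    and idem: "idempotent_cell B J" and sr: "strongly_regular_cell B J"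
  shows "minimal_semimodule (cell_carrier B L) (bool_add B) (bool_class B 0) (cell_act B L)"
proof -
  obtain k0 where k0: "k0 \<in> L" using left_cell_nonempty[OF L(1)] by auto
  have LB: "L \<subseteq> B" using left_cell_iff[OF L(1) k0] by auto
  interpret semimodule "cell_carrier B L" "bool_add B" "bool_class B 0" "cell_act B L"
    using semimodule_cell[OF L(1) LB] .
  show ?thesis
  proof
    have "bool_class B k0 \<noteq> bool_class B 0"
      using k0 LB by (auto simp: bool_class_eq_iff supp_basis)
    then show "cell_carrier B L \<noteq> {bool_class B 0}"
      using cell_carrier.gen[OF k0] by blast
  next
    fix N assume "subsemimodule N"
    then have N: "N \<subseteq> cell_carrier B L" "bool_class B 0 \<in> N"
      "\<And>X Y. X \<in> N \<Longrightarrow> Y \<in> N \<Longrightarrow> bool_add B X Y \<in> N"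
      "\<And>r X. X \<in> N \<Longrightarrow> cell_act B L r X \<in> N"
      by (auto simp: subsemimodule_def)
    have "N = cell_carrier B L" if "N \<noteq> {bool_class B 0}"
    proof -
      from that N(1,2) obtain x where x: "supp x \<subseteq> L" "bool_class B x \<in> N"
        "bool_class B x \<noteq> bool_class B 0"
        unfolding cell_carrier_eq[OF LB] by blast
      then obtain k where k: "k \<in> supp x" by (auto simp: bool_class_eq_iff)
      have gen: "bool_class B i \<in> N" if i: "i \<in> L" for i
      proof -
        have "k \<in> L" using k x(1) by auto
        then obtain b where "supp (b * x) \<inter> L = {i}"
          using exists_matrix_unit[OF J idem sr L _ i] k by metis
        then have "cell_act B L b (bool_class B x) = bool_class B i"
          using i LB by (auto simp: cell_act_class bool_class_eq_iff supp_lincomb supp_basis)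
        then show ?thesis using N(4)[OF x(2), of b] by simp
      qed
      have "cell_carrier B L \<subseteq> N"
        unfolding cell_carrier_eq[OF LB]
        using bool_class_in_closed_family[OF N(2,3)] gen by blast
      then show ?thesis using N(1) by auto
    qed
    then show "N = {bool_class B 0} \<or> N = cell_carrier B L" by blast
  qed
qed

end

theorem theorem9p5:
  fixes B L J :: "'a::{semiring_0, monoid_mult} set"
  assumes "finite_nat_basis B"
    and "L \<in> left_cells B"
    and "J \<in> two_sided_cells B"
    and "L \<subseteq> J"
    and "idempotent_cell B J"
    and "strongly_regular_cell B J"
  shows "minimal_semimodule (cell_carrier B L) (bool_add B) (bool_class B 0) (cell_act B L)"
proof -
  interpret nat_based_semiring B
    using assms(1) by unfold_locales
  show ?thesis
    using minimal_semimodule_cell assms by blast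
qed

end
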